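(* Let $m$ be a positive even integer, $n$ a positive integer, let $u_0,u_1,\dots,u_{(n-1)m}$ be pairwise distinct real numbers, and set $\mathbf{u}_k=(1,u_k,\dots,u_k^{n-1})^\top\in\mathbb{R}^n$ for $k=0,\dots,(n-1)m$. Let $$G=\Big\{\boldsymbol{\alpha}\in\mathbb{R}^{(n-1)m+1}:\sum_{k=0}^{(n-1)m}\alpha_k\mathbf{u}_k^{\otimes m}\in PSD_{m,n}\Big\}.$$ Then the dual cone of $G$ is the closure of the set $$H=\Big\{(\mathcal{A}\mathbf{u}_0^m,\mathcal{A}\mathbf{u}_1^m,\dots,\mathcal{A}\mathbf{u}_{(n-1)m}^m)^\top\in\mathbb{R}^{(n-1)m+1}:\ \mathcal{A}\in U_{m,n}\Big\}.$$
   Context: $S_{m,n}$ is the space of real symmetric tensors $\mathcal{A}=(a_{i_1\cdots i_m})$ of order $m$ and dimension $n$; $\mathcal{A}\mathbf{x}^m=\sum_{i_1,\dots,i_m}a_{i_1\cdots i_m}x_{i_1}\cdots x_{i_m}$ for $\mathbf{x}\in\mathbb{R}^n$; for $\mathbf{x}\in\mathbb{R}^n$, $\mathbf{x}^{\otimes m}\in S_{m,n}$ is the rank-one tensor with entries $x_{i_1}\cdots x_{i_m}$. $PSD_{m,n}=\{\mathcal{A}\in S_{m,n}:\mathcal{A}\mathbf{x}^m\ge 0\text{ for all }\mathbf{x}\in\mathbb{R}^n\}$. $U_{m,n}=\operatorname{conv}\{\mathbf{x}^{\otimes m}:\mathbf{x}\in\mathbb{R}^n\}$ (convex hull in $S_{m,n}$).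 For $S\subseteq\mathbb{R}^N$, the dual cone is $S^*=\{\mathbf{y}\in\mathbb{R}^N:\mathbf{y}\bullet\mathbf{x}\ge 0\text{ for all }\mathbf{x}\in S\}$, where $\bullet$ is the standard inner product. *)

theory Defs
  imports "HOL-Analysis.Analysis"
begin

(* A real tensor of order CARD('m) and dimension CARD('n): its entries are indexed by
   the multi-indices i :: 'm => 'n, where i j is the j-th of the subscripts i_1, ..., i_m. *)
type_synonym ('m, 'n) tensor = "(real, 'm \<Rightarrow> 'n) vec"

definition symmetric_tensors :: "('m::finite, 'n::finite) tensor set" where
  "symmetric_tensors = {A. \<forall>p i. bij p \<longrightarrow> A $ (i \<circ> p) = A $ i}"

definition tensor_form :: "('m::finite, 'n::finite) tensor \<Rightarrow> real ^ 'n \<Rightarrow> real" where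
  "tensor_form A x = (\<Sum>i\<in>UNIV. A $ i * (\<Prod>j\<in>UNIV. x $ i j))"

definition rank_one :: "real ^ 'n \<Rightarrow> ('m::finite, 'n::finite) tensor" where
  "rank_one x = (\<chi> i. \<Prod>j\<in>UNIV. x $ i j)"

definition PSD :: "('m::finite, 'n::finite) tensor set" where
  "PSD = {A \<in> symmetric_tensors. \<forall>x. tensor_form A x \<ge> 0}"

(* The hull is taken in the space of all tensors. By rank_one_symmetric and
   subspace_symmetric_tensors below it is the same as the hull taken in symmetric_tensors. *)
definition U_tensors :: "('m::finite, 'n::finite) tensor set" where
  "U_tensors = convex hull range rank_one"

definition dual_cone :: "'a::real_inner set \<Rightarrow> 'a set" where
  "dual_cone S = {y. \<forall>x\<in>S. y \<bullet> x \<ge> 0}"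

(* The linear order on 'n only serves to number the coordinates 0, ..., CARD('n) - 1
   (see bij_betw_coord). *)
definition coord :: "'n::{finite,linorder} \<Rightarrow> nat" where
  "coord i = card {j. j < i}"

definition power_vec :: "real \<Rightarrow> real ^ 'n::{finite,linorder}" where
  "power_vec t = (\<chi> i. t ^ coord i)"

lemma bij_betw_coord: "bij_betw (coord :: 'n::{finite,linorder} \<Rightarrow> nat) UNIV {..<CARD('n)}"
proof -
  have mono: "coord i < coord j" if "i < j" for i j :: 'n
    unfolding coord_def using that by (intro psubset_card_mono) auto
  have "inj (coord :: 'n \<Rightarrow> nat)"
    by (rule injI) (metis mono less_irrefl linorder_less_linear)
  moreover have "range (coord :: 'n \<Rightarrow> nat) \<subseteq> {..<CARD('n)}"
    unfolding coord_def by (auto intro!: psubset_card_mono)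
  ultimately show ?thesis
    unfolding bij_betw_def by (simp add: card_image card_subset_eq)
qed

lemma rank_one_symmetric: "rank_one x \<in> symmetric_tensors"
  unfolding symmetric_tensors_def rank_one_def
  by (auto intro!: prod.reindex_bij_betw)

lemma subspace_symmetric_tensors: "subspace symmetric_tensors"
  unfolding symmetric_tensors_def by (rule subspaceI) auto

end

theory Submission imports Defs begin

text \<open>
  Pairing \<open>\<Sum>k. \<alpha>\<^sub>k u\<^sub>k\<^sup>\<otimes>\<^sup>m\<close> with \<open>x\<^sup>\<otimes>\<^sup>m\<close> equals pairing \<open>\<alpha>\<close> with the evaluations of \<open>x\<^sup>\<otimes>\<^sup>m\<close>
  at the points \<open>u\<^sub>k\<close>. Hence \<open>G\<close> is the dual cone of \<open>H\<close>. Since \<open>H\<close> is a convex cone, the bipolar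
  theorem identifies the dual cone of \<open>G\<close> with the closure of \<open>H\<close>.
\<close>

text \<open>For fixed \<open>y\<close> the condition cuts out a half-space, which is convex.
  Membership in the dual cone can thus be tested on generators, here the rank-one tensors.\<close>

lemma dual_cone_convex_hull: "dual_cone (convex hull S) = dual_cone S"
proof
  show "dual_cone (convex hull S) \<subseteq> dual_cone S"
    using hull_subset[of S convex] by (auto simp: dual_cone_def)
  show "dual_cone S \<subseteq> dual_cone (convex hull S)"
  proof
    fix y assume "y \<in> dual_cone S"
    then have "convex hull S \<subseteq> {x. y \<bullet> x \<ge> 0}"
      by (intro hull_minimal convex_halfspace_ge) (auto simp: dual_cone_def)
    then show "y \<in> dual_cone (convex hull S)"
      by (auto simp: dual_cone_def)
  qed
qed

lemma closed_dual_cone: "closed (dual_cone S)"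
proof -
  have "dual_cone S = (\<Inter>x\<in>S. {y. x \<bullet> y \<ge> 0})"
    by (auto simp: dual_cone_def inner_commute)
  then show ?thesis
    by (auto intro!: closed_INT closed_halfspace_ge)
qed

text \<open>The bipolar theorem: a point outside the closure would be strictly separated from it,
  and the cone property turns the separating normal into an element of the dual cone.\<close>

lemma dual_cone_dual_cone:
  fixes S :: "'a::euclidean_space set"
  assumes "convex S" "cone S" "S \<noteq> {}"
  shows "dual_cone (dual_cone S) = closure S"
proof
  show "closure S \<subseteq> dual_cone (dual_cone S)"
    by (rule closure_minimal[OF _ closed_dual_cone]) (auto simp: dual_cone_def inner_commute)
  show "dual_cone (dual_cone S) \<subseteq> closure S"
  proof (rule subsetI, rule ccontr)
    fix y assume y: "y \<in> dual_cone (dual_cone S)" and "y \<notin> closure S"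
    then obtain a b where ab: "a \<bullet> y < b" "\<And>x. x \<in> closure S \<Longrightarrow> a \<bullet> x > b"
      using separating_hyperplane_closed_point[of "closure S" y] assms(1)
      by (auto simp: convex_closure)
    have "0 \<in> S"
      using assms(2,3) cone_contains_0 by blast
    then have "b < 0"
      using ab(2)[of 0] closure_subset[of S] by auto
    \<comment> \<open>If \<open>a \<bullet> x\<close> were negative, scaling \<open>x\<close> by the
      positive number \<open>b / (a \<bullet> x)\<close> would give a point of the cone whose
      product with \<open>a\<close> is exactly \<open>b\<close>, against the strict bound.\<close>
    have "a \<bullet> x \<ge> 0" if "x \<in> S" for x
    proof (rule ccontr)
      assume neg: "\<not> a \<bullet> x \<ge> 0"
      with \<open>b < 0\<close> have "(b / (a \<bullet> x)) *\<^sub>R x \<in> closure S"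
        using assms(2) that closure_subset[of S] by (auto simp: cone_def divide_nonpos_neg)
      from ab(2)[OF this] neg show False
        by simp
    qed
    then have "a \<in> dual_cone S"
      by (simp add: dual_cone_def)
    with y ab(1) \<open>b < 0\<close> show False
      by (fastforce simp: dual_cone_def inner_commute)
  qed
qed

lemma tensor_form_eq_inner: "tensor_form A x = A \<bullet> rank_one x"
  by (simp add: tensor_form_def rank_one_def inner_vec_def)

lemma rank_one_scaleR:
  "rank_one (c *\<^sub>R x) = c ^ CARD('m) *\<^sub>R (rank_one x :: ('m::finite, 'n::finite) tensor)"
  by (simp add: rank_one_def vec_eq_iff prod.distrib)

text \<open>A factor \<open>c \<ge> 0\<close> is absorbed into the vector through its root of order
  \<open>CARD('m)\<close>. This makes the convex hull a cone although its weights sum to 1.\<close>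

lemma cone_range_rank_one: "cone (range rank_one :: ('m::finite, 'n::finite) tensor set)"
proof -
  have "c *\<^sub>R (rank_one x :: ('m, 'n) tensor) \<in> range rank_one" if "c \<ge> 0" for c x
  proof -
    have "c *\<^sub>R (rank_one x :: ('m, 'n) tensor) = rank_one (root CARD('m) c *\<^sub>R x)"
      using that by (simp add: rank_one_scaleR)
    then show ?thesis
      by simp
  qed
  then show ?thesis
    by (auto simp: cone_def)
qed

lemma linear_tensor_evaluations:
  "linear (\<lambda>A. \<chi> k. tensor_form A (v k) :: real ^ 'k::finite)"
  by (rule linearI) (simp_all add: vec_eq_iff tensor_form_eq_inner inner_add_left)

text \<open>The sum is symmetric automatically, so only nonnegativity of its form matters. That form
  at \<open>x\<close> is an inner product with \<open>\<alpha>\<close>, because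
  \<open>rank_one x\<close> and \<open>rank_one (v k)\<close> pair symmetrically.\<close>

lemma sum_rank_one_in_PSD_iff:
  fixes v :: "'k::finite \<Rightarrow> real ^ 'n::finite" and \<alpha> :: "real ^ 'k"
  shows "(\<Sum>k\<in>UNIV. \<alpha> $ k *\<^sub>R rank_one (v k)) \<in> (PSD :: ('m::finite, 'n) tensor set) \<longleftrightarrow>
    \<alpha> \<in> dual_cone (range (\<lambda>x. \<chi> k. tensor_form (rank_one x :: ('m, 'n) tensor) (v k)))"
proof -
  have "(\<Sum>k\<in>UNIV. \<alpha> $ k *\<^sub>R rank_one (v k)) \<in> (symmetric_tensors :: ('m, 'n) tensor set)"
    by (intro subspace_sum subspace_scale subspace_symmetric_tensors rank_one_symmetric)
  moreover have "tensor_form (\<Sum>k\<in>UNIV. \<alpha> $ k *\<^sub>R (rank_one (v k) :: ('m, 'n) tensor)) x =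
      \<alpha> \<bullet> (\<chi> k. tensor_form (rank_one x :: ('m, 'n) tensor) (v k))" for x
    by (simp add: tensor_form_eq_inner inner_sum_left inner_vec_def[of \<alpha>]
        inner_commute[of "rank_one x"])
  ultimately show ?thesis
    by (simp add: PSD_def dual_cone_def)
qed

theorem theorem2:
  fixes u :: "'k::finite \<Rightarrow> real"
    and G H :: "(real ^ 'k) set"
  assumes "even CARD('m::finite)"
    and "CARD('k) = (CARD('n::{finite,linorder}) - 1) * CARD('m) + 1"
    and "inj u"
    and "G = {\<alpha>. (\<Sum>k\<in>UNIV. \<alpha> $ k *\<^sub>R rank_one (power_vec (u k))) \<in> (PSD :: ('m, 'n) tensor set)}"
    and "H = {(\<chi> k. tensor_form A (power_vec (u k))) | A. A \<in> (U_tensors :: ('m, 'n) tensor set)}"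
  shows "dual_cone G = closure H"
proof -
  define L where "L = (\<lambda>A :: ('m, 'n) tensor. \<chi> k. tensor_form A (power_vec (u k)))"
  have L: "linear L"
    unfolding L_def by (rule linear_tensor_evaluations)
  have H: "H = L ` (convex hull range rank_one)"
    unfolding assms(5) L_def U_tensors_def by auto
  \<comment> \<open>Moving the hull outside \<open>L\<close> lets the dual cone of \<open>H\<close>
    see only the evaluations of rank-one tensors.\<close>
  also have "\<dots> = convex hull range (\<lambda>x. L (rank_one x))"
    by (simp add: convex_hull_linear_image[OF L] image_image)
  finally have "G = dual_cone H"
    unfolding assms(4) L_def by (auto simp: sum_rank_one_in_PSD_iff dual_cone_convex_hull)
  moreover have "convex H"
    unfolding H by (intro convex_linear_image L convex_convex_hull)
  moreover have "cone H"
    \<comment> \<open>Linearity of \<open>L\<close> carries the cone property from the tensors over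
      to their evaluations.\<close>
    using cone_convex_hull[OF cone_range_rank_one] unfolding H cone_def
    by (auto simp: linear_scale[OF L, symmetric])
  moreover have "H \<noteq> {}"
    unfolding H by simp
  ultimately show ?thesis
    by (simp add: dual_cone_dual_cone)
qed

end
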